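(* Let $\Bbbk$ be a field with $\mathrm{char}(\Bbbk)=0$ and let $A$ be an affine Poisson domain over $\Bbbk$ such that $\mathrm{PML}(A)=A$. Then (a) $\mathrm{PML}(A[x;\delta]_P)=\mathrm{PML}(A)$ for every Poisson derivation $\delta$ of $A$, and (b) $A$ is Poisson $\delta$-cancellative.
   Context: A Poisson algebra is a commutative $\Bbbk$-algebra with a $\Bbbk$-bilinear bracket $\{-,-\}$ that is a Lie bracket and a biderivation; a Poisson domain is a Poisson algebra that is a domain; affine means finitely generated as a $\Bbbk$-algebra. A Poisson derivation of $A$ is a $\Bbbk$-linear derivation $\delta$ with $\delta(\{a,b\})=\{\delta(a),b\}+\{a,\delta(b)\}$; it is locally nilpotent if for every $a\in A$ one has $\delta^n(a)=0$ for $n\gg0$. The Poisson Makar-Limanov invariant $\mathrm{PML}(A)$ is the intersection of $\ker\partial$ over all locally nilpotent Poisson derivations $\partial$ of $A$. For a Poisson derivation $\delta$ of $A$, the Poisson-Ore extension $A[x;\delta]_P$ is the polynomial ring $A[x]$ with the Poisson bracket extending that of $A$ and satisfying $\{a,x\}=\delta(a)$ for $a\in A$; $A$ is viewed as a subalgebra of it. $A$ is Poisson $\delta$-cancellative if any Poisson isomorphism $A[x;\delta]_P\cong B[y;\delta']_P$, with $B$ a Poisson algebra and $\delta,\delta'$ Poisson derivations of $A$ and $B$ respectively, implies a Poisson isomorphism $A\cong B$. *)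

theory Defs
  imports "HOL-Computational_Algebra.Polynomial"
begin

section \<open>Poisson algebras\<close>

text \<open>
  An algebra over the field \<open>'k\<close> is a type \<open>'a\<close> of class \<^class>\<open>comm_ring_1\<close> together with an explicit
  scalar multiplication \<open>scale\<close>; a Poisson algebra carries a bracket \<open>br\<close> in addition. A Poisson
  domain is a Poisson algebra whose carrier type is of class \<^class>\<open>idom\<close>.
\<close>

locale comm_algebra = vector_space scale
  for scale :: "'k::field \<Rightarrow> 'a::comm_ring_1 \<Rightarrow> 'a" +
  assumes scale_mult_left: "scale c a * b = scale c (a * b)"

locale poisson_algebra = comm_algebra scale
  for scale :: "'k::field \<Rightarrow> 'a::comm_ring_1 \<Rightarrow> 'a" +
  fixes br :: "'a \<Rightarrow> 'a \<Rightarrow> 'a"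
  assumes br_linear_right: "Vector_Spaces.linear scale scale (\<lambda>b. br a b)"
    and br_linear_left: "Vector_Spaces.linear scale scale (\<lambda>a. br a b)"
    and br_self: "br a a = 0"
    and br_jacobi: "br a (br b c) + br b (br c a) + br c (br a b) = 0"
    and br_mult_right: "br a (b * c) = br a b * c + b * br a c"
    and br_mult_left: "br (a * b) c = a * br b c + br a c * b"

definition subalgebra :: "('k::field \<Rightarrow> 'a::comm_ring_1 \<Rightarrow> 'a) \<Rightarrow> 'a set \<Rightarrow> bool" where
  "subalgebra scale S \<longleftrightarrow>
     module.subspace scale S \<and> 1 \<in> S \<and> (\<forall>a\<in>S. \<forall>b\<in>S. a * b \<in> S)"

definition affine_algebra :: "('k::field \<Rightarrow> 'a::comm_ring_1 \<Rightarrow> 'a) \<Rightarrow> bool" where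
  "affine_algebra scale \<longleftrightarrow> (\<exists>S. finite S \<and> subalgebra scale hull S = UNIV)"

definition poisson_derivation ::
  "('k::field \<Rightarrow> 'a::comm_ring_1 \<Rightarrow> 'a) \<Rightarrow> ('a \<Rightarrow> 'a \<Rightarrow> 'a) \<Rightarrow> ('a \<Rightarrow> 'a) \<Rightarrow> bool" where
  "poisson_derivation scale br d \<longleftrightarrow>
     Vector_Spaces.linear scale scale d \<and>
     (\<forall>a b. d (a * b) = d a * b + a * d b) \<and>
     (\<forall>a b. d (br a b) = br (d a) b + br a (d b))"

definition locally_nilpotent :: "('a::zero \<Rightarrow> 'a) \<Rightarrow> bool" where
  "locally_nilpotent d \<longleftrightarrow> (\<forall>a. \<exists>N. \<forall>n\<ge>N. (d ^^ n) a = 0)"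

definition PML :: "('k::field \<Rightarrow> 'a::comm_ring_1 \<Rightarrow> 'a) \<Rightarrow> ('a \<Rightarrow> 'a \<Rightarrow> 'a) \<Rightarrow> 'a set" where
  "PML scale br =
     (\<Inter>d \<in> {d. poisson_derivation scale br d \<and> locally_nilpotent d}. {a. d a = 0})"

definition poisson_iso ::
  "('k::field \<Rightarrow> 'a::comm_ring_1 \<Rightarrow> 'a) \<Rightarrow> ('a \<Rightarrow> 'a \<Rightarrow> 'a) \<Rightarrow>
   ('k \<Rightarrow> 'b::comm_ring_1 \<Rightarrow> 'b) \<Rightarrow> ('b \<Rightarrow> 'b \<Rightarrow> 'b) \<Rightarrow> ('a \<Rightarrow> 'b) \<Rightarrow> bool" where
  "poisson_iso scaleA brA scaleB brB f \<longleftrightarrow>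
     bij f \<and> Vector_Spaces.linear scaleA scaleB f \<and>
     f 1 = 1 \<and> (\<forall>a b. f (a * b) = f a * f b) \<and>
     (\<forall>a b. f (brA a b) = brB (f a) (f b))"

definition poisson_isomorphic ::
  "('k::field \<Rightarrow> 'a::comm_ring_1 \<Rightarrow> 'a) \<Rightarrow> ('a \<Rightarrow> 'a \<Rightarrow> 'a) \<Rightarrow>
   ('k \<Rightarrow> 'b::comm_ring_1 \<Rightarrow> 'b) \<Rightarrow> ('b \<Rightarrow> 'b \<Rightarrow> 'b) \<Rightarrow> bool" where
  "poisson_isomorphic scaleA brA scaleB brB \<longleftrightarrow> (\<exists>f. poisson_iso scaleA brA scaleB brB f)"


section \<open>Poisson-Ore extensions\<close>

definition poly_scale :: "('k \<Rightarrow> 'a \<Rightarrow> 'a) \<Rightarrow> 'k \<Rightarrow> 'a::comm_ring_1 poly \<Rightarrow> 'a poly" where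
  "poly_scale scale c = map_poly (scale c)"

text \<open>
  The bracket of \<open>A[x;\<delta>]\<^sub>P\<close>. Bilinearity, the Leibniz rules and \<open>{a,x} = \<delta>(a)\<close> force
  \<open>{a x\<^sup>i, b x\<^sup>j} = {a,b} x\<^sup>i\<^sup>+\<^sup>j + (j \<delta>(a) b - i a \<delta>(b)) x\<^sup>i\<^sup>+\<^sup>j\<^sup>-\<^sup>1\<close>; for \<open>i = j = 0\<close> the coefficient of the
  second monomial is \<open>0\<close>, so the truncated exponent is harmless. Lemmas \<open>ore_br_poisson_algebra\<close>,
  \<open>ore_br_const\<close>, \<open>ore_br_const_x\<close> and \<open>ore_br_unique\<close> below show that this is a Poisson bracket
  extending \<open>br\<close> with \<open>{a,x} = \<delta>(a)\<close>, and the only one.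
\<close>

definition ore_br ::
  "('a \<Rightarrow> 'a \<Rightarrow> 'a) \<Rightarrow> ('a \<Rightarrow> 'a) \<Rightarrow> 'a::comm_ring_1 poly \<Rightarrow> 'a poly \<Rightarrow> 'a poly" where
  "ore_br br \<delta> p q =
     (\<Sum>i\<le>degree p. \<Sum>j\<le>degree q.
        monom (br (coeff p i) (coeff q j)) (i + j) +
        monom (of_nat j * \<delta> (coeff p i) * coeff q j - of_nat i * coeff p i * \<delta> (coeff q j))
          (i + j - 1))"

text \<open>
  \<open>A\<close> is Poisson \<open>\<delta>\<close>-cancellative with respect to all Poisson algebras \<open>B\<close> with carrier type \<open>'b\<close>.
  HOL cannot quantify over types inside a formula, so the quantification over all carriers is
  obtained by leaving \<open>'b\<close> free in a theorem. The zero algebra is not of class \<^class>\<open>comm_ring_1\<close>,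
  but its Poisson-Ore extension is zero, hence not isomorphic to one of a nonzero algebra.
\<close>

definition poisson_delta_cancellative ::
  "'b::comm_ring_1 itself \<Rightarrow> ('k::field \<Rightarrow> 'a::comm_ring_1 \<Rightarrow> 'a) \<Rightarrow> ('a \<Rightarrow> 'a \<Rightarrow> 'a) \<Rightarrow> bool" where
  "poisson_delta_cancellative TYPE('b) scale br \<longleftrightarrow>
     (\<forall>(scaleB :: 'k \<Rightarrow> 'b \<Rightarrow> 'b) brB \<delta> \<delta>'.
        poisson_algebra scaleB brB \<longrightarrow>
        poisson_derivation scale br \<delta> \<longrightarrow>
        poisson_derivation scaleB brB \<delta>' \<longrightarrow>
        poisson_isomorphic (poly_scale scale) (ore_br br \<delta>) (poly_scale scaleB) (ore_br brB \<delta>') \<longrightarrow>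
        poisson_isomorphic scale br scaleB brB)"


section \<open>The bracket of a Poisson-Ore extension is well defined\<close>

definition psum :: "(nat \<Rightarrow> 'a::comm_ring_1 \<Rightarrow> 'b::ab_group_add) \<Rightarrow> 'a poly \<Rightarrow> 'b" where
  "psum g p = (\<Sum>i\<le>degree p. g i (coeff p i))"

lemma psum_eq:
  assumes "\<And>i. additive (g i)" "degree p \<le> N"
  shows "psum g p = (\<Sum>i\<le>N. g i (coeff p i))"
  unfolding psum_def using assms(2)
  by (intro sum.mono_neutral_left) (auto simp: coeff_eq_0 additive.zero[OF assms(1)])

lemma psum_add:
  assumes "\<And>i. additive (g i)"
  shows "psum g (p + q) = psum g p + psum g q"
proof -
  define N where "N = max (degree p) (degree q)"
  have "degree p \<le> N" "degree q \<le> N" "degree (p + q) \<le> N"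
    by (auto simp: N_def intro: degree_add_le)
  then show ?thesis
    by (simp add: psum_eq[OF assms] additive.add[OF assms] sum.distrib)
qed

lemma psum_monom:
  assumes "\<And>i. additive (g i)"
  shows "psum g (monom a n) = g n a"
proof -
  have "psum g (monom a n) = (\<Sum>i\<le>n. g i (if n = i then a else 0))"
    by (simp add: psum_eq[OF assms degree_monom_le])
  also have "\<dots> = (\<Sum>i\<le>n. if n = i then g i a else 0)"
    by (intro sum.cong) (auto simp: additive.zero[OF assms])
  finally show ?thesis by simp
qed

lemma poly_monom_induct:
  assumes "\<And>a n. P (monom a n)" "\<And>p q. P p \<Longrightarrow> P q \<Longrightarrow> P (p + q)"
  shows "P p"
proof -
  have "P (\<Sum>i\<le>n. monom (coeff p i) i)" for n
    by (induction n) (auto intro: assms)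
  then show ?thesis using poly_as_sum_of_monoms[of p] by metis
qed

lemma (in comm_algebra) linear_iff_scale:
  "Vector_Spaces.linear scale scale f \<longleftrightarrow>
     (\<forall>a b. f (a + b) = f a + f b) \<and> (\<forall>c a. f (scale c a) = scale c (f a))"
  using vector_space_axioms
  by (auto simp: Vector_Spaces.linear_def module_hom_def module_hom_axioms_def module_iff_vector_space)

lemma (in comm_algebra) poly_scale_monom: "poly_scale scale c (monom a n) = monom (scale c a) n"
  by (simp add: poly_scale_def map_poly_monom)

lemma (in comm_algebra) coeff_poly_scale: "coeff (poly_scale scale c p) n = scale c (coeff p n)"
  by (simp add: poly_scale_def coeff_map_poly)

lemma (in comm_algebra) poly_scale_add:
  "poly_scale scale c (p + q) = poly_scale scale c p + poly_scale scale c q"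
  by (rule poly_eqI) (simp add: coeff_poly_scale scale_right_distrib)

lemma (in comm_algebra) poly_scale_smult: "poly_scale scale c p = smult (scale c 1) p"
  by (rule poly_eqI) (simp add: coeff_poly_scale scale_mult_left)

lemma (in comm_algebra) poly_comm_algebra: "comm_algebra (poly_scale scale)"
proof unfold_locales
  show "poly_scale scale a p * q = poly_scale scale a (p * q)" for a p q
    by (simp add: poly_scale_smult)
qed (auto intro!: poly_eqI simp: coeff_poly_scale scale_right_distrib scale_left_distrib)

locale poisson_ore = poisson_algebra scale br
  for scale :: "'k::field \<Rightarrow> 'a::comm_ring_1 \<Rightarrow> 'a" and br +
  fixes \<delta> :: "'a \<Rightarrow> 'a"
  assumes deriv: "poisson_derivation scale br \<delta>"
begin

lemma br_add_r: "br a (b + c) = br a b + br a c"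
  using br_linear_right by (simp add: linear_iff_scale)

lemma br_add_l: "br (a + b) c = br a c + br b c"
  using br_linear_left by (simp add: linear_iff_scale)

lemma br_scale_r: "br a (scale c b) = scale c (br a b)"
  using br_linear_right by (simp add: linear_iff_scale)

lemma br_scale_l: "br (scale c a) b = scale c (br a b)"
  using br_linear_left by (simp add: linear_iff_scale)

lemma \<delta>_add: "\<delta> (a + b) = \<delta> a + \<delta> b"
  and \<delta>_scale: "\<delta> (scale c a) = scale c (\<delta> a)"
  and \<delta>_mult: "\<delta> (a * b) = \<delta> a * b + a * \<delta> b"
  and \<delta>_br: "\<delta> (br a b) = br (\<delta> a) b + br a (\<delta> b)"
  using deriv by (simp_all add: poisson_derivation_def linear_iff_scale)

lemma br_add_r_additive: "additive (br a)"
  by (rule additive.intro) (rule br_add_r)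

lemma br_add_l_additive: "additive (\<lambda>a. br a b)"
  by (rule additive.intro) (rule br_add_l)

lemma \<delta>_additive: "additive \<delta>"
  by (rule additive.intro) (rule \<delta>_add)

lemmas \<delta>_zero [simp] = additive.zero[OF \<delta>_additive]
lemmas br_zero_r [simp] = additive.zero[OF br_add_r_additive]
lemmas br_zero_l [simp] = additive.zero[OF br_add_l_additive]
lemmas br_minus_r [simp] = additive.minus[OF br_add_r_additive]
lemmas br_minus_l [simp] = additive.minus[OF br_add_l_additive]

lemma br_skew: "br a b = - br b a"
proof -
  have "br (a + b) (a + b) = 0" by (rule br_self)
  then have "br a b + br b a = 0" by (simp add: br_add_l br_add_r br_self[of a] br_self[of b] add.commute)
  then show ?thesis by (simp add: eq_neg_iff_add_eq_0)
qed

lemma \<delta>_one [simp]: "\<delta> 1 = 0"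
  using \<delta>_mult[of 1 1] by simp

lemma \<delta>_of_nat [simp]: "\<delta> (of_nat n) = 0"
  by (induction n) (simp_all add: \<delta>_add)

lemma br_one_l [simp]: "br 1 a = 0"
  using br_mult_left[of 1 1 a] by simp

lemma br_of_nat_l [simp]: "br (of_nat n) a = 0"
  by (induction n) (simp_all add: br_add_l)

lemma br_of_nat_r [simp]: "br a (of_nat n) = 0"
  using br_skew[of a "of_nat n"] by simp

text \<open>\<open>B0\<close> is the \<open>x\<close>-linear extension of \<open>br\<close>; \<open>Dl\<close> and \<open>DX\<close> are the coefficientwise extension of
  \<open>\<delta>\<close> and the derivative in \<open>x\<close>, which are commuting Poisson derivations for \<open>B0\<close>.\<close>

definition "B0 p q = psum (\<lambda>i a. psum (\<lambda>j b. monom (br a b) (i + j)) q) p"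
definition "DX p = psum (\<lambda>i a. monom (of_nat i * a) (i - 1)) p"
definition "Dl p = psum (\<lambda>i a. monom (\<delta> a) i) p"

lemma B0_inner: "additive (\<lambda>b. monom (br a b) (i + j))"
  by (rule additive.intro) (simp add: br_add_r add_monom)

lemma B0_outer: "additive (\<lambda>a. psum (\<lambda>j b. monom (br a b) (i + j)) q)"
  by (rule additive.intro) (simp add: br_add_l psum_def sum.distrib flip: add_monom)

lemma B0_add_l: "B0 (p + p') q = B0 p q + B0 p' q"
  unfolding B0_def by (rule psum_add) (rule B0_outer)

lemma B0_add_r: "B0 p (q + q') = B0 p q + B0 p q'"
proof -
  have "psum (\<lambda>j b. monom (br a b) (i + j)) (q + q') =
      psum (\<lambda>j b. monom (br a b) (i + j)) q + psum (\<lambda>j b. monom (br a b) (i + j)) q'" for a i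
    by (rule psum_add) (rule B0_inner)
  then show ?thesis
    by (simp add: B0_def psum_def[of _ p] sum.distrib)
qed

lemma B0_monom: "B0 (monom a i) (monom b j) = monom (br a b) (i + j)"
  unfolding B0_def by (subst psum_monom[OF B0_outer]) (rule psum_monom[OF B0_inner])

lemma B0_zero [simp]: "B0 0 q = 0" "B0 p 0 = 0"
  using B0_add_l[of 0 0 q] B0_add_r[of p 0 0] by simp_all

lemma DX_additive: "additive (\<lambda>a. monom (of_nat i * a) (i - 1))"
  by (rule additive.intro) (simp add: distrib_left add_monom)

lemma Dl_additive: "additive (\<lambda>a. monom (\<delta> a) i)"
  by (rule additive.intro) (simp add: \<delta>_add add_monom)

lemma DX_add: "DX (p + q) = DX p + DX q"
  unfolding DX_def by (rule psum_add) (rule DX_additive)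

lemma Dl_add: "Dl (p + q) = Dl p + Dl q"
  unfolding Dl_def by (rule psum_add) (rule Dl_additive)

lemma DX_monom: "DX (monom a i) = monom (of_nat i * a) (i - 1)"
  unfolding DX_def by (rule psum_monom) (rule DX_additive)

lemma Dl_monom: "Dl (monom a i) = monom (\<delta> a) i"
  unfolding Dl_def by (rule psum_monom) (rule Dl_additive)

lemma DX_mult: "DX (p * q) = DX p * q + p * DX q"
proof (induction p rule: poly_monom_induct)
  case (1 a i)
  show ?case
  proof (induction q rule: poly_monom_induct)
    case (1 b j)
    show ?case
      by (cases i; cases j)
        (simp_all add: DX_monom mult_monom add_monom algebra_simps)
  qed (simp add: DX_add algebra_simps)
qed (simp add: DX_add algebra_simps)

lemma Dl_mult: "Dl (p * q) = Dl p * q + p * Dl q"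
proof (induction p rule: poly_monom_induct)
  case (1 a i)
  show ?case
    by (induction q rule: poly_monom_induct)
      (simp_all add: Dl_monom mult_monom add_monom Dl_add \<delta>_mult algebra_simps)
qed (simp add: Dl_add algebra_simps)

lemma Dl_DX: "Dl (DX p) = DX (Dl p)"
  by (induction p rule: poly_monom_induct)
    (simp_all add: Dl_monom DX_monom Dl_add DX_add \<delta>_mult)

lemma B0_mult_r: "B0 p (q * r) = B0 p q * r + q * B0 p r"
proof (induction p rule: poly_monom_induct)
  case p: (1 a i)
  show ?case
  proof (induction q rule: poly_monom_induct)
    case q: (1 b j)
    show ?case
      by (induction r rule: poly_monom_induct)
        (simp_all add: B0_monom mult_monom add_monom B0_add_r br_mult_right algebra_simps)
  qed (simp add: B0_add_r algebra_simps)
qed (simp add: B0_add_l algebra_simps)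

lemma B0_skew: "B0 p q = - B0 q p"
proof (induction p rule: poly_monom_induct)
  case p: (1 a i)
  show ?case
    by (induction q rule: poly_monom_induct)
      (simp_all add: B0_monom minus_monom br_skew[of a] B0_add_r B0_add_l add.commute)
qed (simp add: B0_add_l B0_add_r)

lemma B0_self: "B0 p p = 0"
proof (induction p rule: poly_monom_induct)
  case (2 p q)
  then show ?case using B0_skew[of p q] by (simp add: B0_add_l B0_add_r)
qed (simp add: B0_monom br_self)

lemma B0_jacobi: "B0 p (B0 q r) + B0 q (B0 r p) + B0 r (B0 p q) = 0"
proof (induction p rule: poly_monom_induct)
  case p: (1 a i)
  show ?case
  proof (induction q rule: poly_monom_induct)
    case q: (1 b j)
    show ?case
    proof (induction r rule: poly_monom_induct)
      case r: (1 c k)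
      show ?case
        using br_jacobi[of a b c] by (simp add: B0_monom add_monom add_ac)
    next
      case (2 r r')
      from arg_cong2[OF this, of "(+)"] show ?case by (simp add: B0_add_l B0_add_r algebra_simps)
    qed
  next
    case (2 q q')
    from arg_cong2[OF this, of "(+)"] show ?case by (simp add: B0_add_l B0_add_r algebra_simps)
  qed
next
  case (2 p p')
  from arg_cong2[OF this, of "(+)"] show ?case by (simp add: B0_add_l B0_add_r algebra_simps)
qed

lemma Dl_B0: "Dl (B0 p q) = B0 (Dl p) q + B0 p (Dl q)"
proof (induction p rule: poly_monom_induct)
  case p: (1 a i)
  show ?case
    by (induction q rule: poly_monom_induct)
      (simp_all add: B0_monom Dl_monom add_monom \<delta>_br B0_add_r B0_add_l Dl_add algebra_simps)
qed (simp add: B0_add_l B0_add_r Dl_add algebra_simps)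

lemma DX_B0: "DX (B0 p q) = B0 (DX p) q + B0 p (DX q)"
proof (induction p rule: poly_monom_induct)
  case p: (1 a i)
  show ?case
  proof (induction q rule: poly_monom_induct)
    case q: (1 b j)
    show ?case
      by (cases i; cases j)
        (simp_all add: B0_monom DX_monom add_monom br_mult_left br_mult_right br_add_l br_add_r
          algebra_simps)
  qed (simp add: B0_add_l B0_add_r DX_add algebra_simps)
qed (simp add: B0_add_l B0_add_r DX_add algebra_simps)

lemma ore_br_term:
  "monom (of_nat j * \<delta> a * b - of_nat i * a * \<delta> b) (i + j - 1) =
     monom (\<delta> a) i * monom (of_nat j * b) (j - 1) - monom (of_nat i * a) (i - 1) * monom (\<delta> b) j"
  by (cases i; cases j) (simp_all add: mult_monom diff_monom minus_monom algebra_simps)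

lemma ore_br_eq: "ore_br br \<delta> p q = B0 p q + Dl p * DX q - DX p * Dl q"
  unfolding ore_br_def B0_def Dl_def DX_def psum_def ore_br_term
  by (simp add: sum.distrib sum_subtractf sum_product)

lemma ore_br_add_l: "ore_br br \<delta> (p + q) r = ore_br br \<delta> p r + ore_br br \<delta> q r"
  by (simp add: ore_br_eq B0_add_l Dl_add DX_add algebra_simps)

lemma ore_br_add_r: "ore_br br \<delta> p (q + r) = ore_br br \<delta> p q + ore_br br \<delta> p r"
  by (simp add: ore_br_eq B0_add_r Dl_add DX_add algebra_simps)

lemma ore_br_monom:
  "ore_br br \<delta> (monom a i) (monom b j) =
     monom (br a b) (i + j) + monom (of_nat j * \<delta> a * b - of_nat i * a * \<delta> b) (i + j - 1)"
  unfolding ore_br_term by (simp add: ore_br_eq B0_monom DX_monom Dl_monom)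

lemma ore_br_skew: "ore_br br \<delta> p q = - ore_br br \<delta> q p"
  using B0_skew[of p q] by (simp add: ore_br_eq algebra_simps)

lemma ore_br_mult_r: "ore_br br \<delta> p (q * r) = ore_br br \<delta> p q * r + q * ore_br br \<delta> p r"
  by (simp add: ore_br_eq B0_mult_r Dl_mult DX_mult algebra_simps)

lemma ore_br_jacobi:
  "ore_br br \<delta> p (ore_br br \<delta> q r) + ore_br br \<delta> q (ore_br br \<delta> r p)
     + ore_br br \<delta> r (ore_br br \<delta> p q) = 0"
proof -
  have neg: "B0 p (- q) = - B0 p q" "Dl (- q) = - Dl q" "DX (- q) = - DX q" for p q
    using additive.minus[of "B0 p" q] additive.minus[of Dl q] additive.minus[of DX q]
    by (auto simp: additive_def B0_add_r Dl_add DX_add)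
  have dif: "B0 p (q - q') = B0 p q - B0 p q'" "Dl (q - q') = Dl q - Dl q'"
    "DX (q - q') = DX q - DX q'" for p q q'
    using B0_add_r[of p q "- q'"] Dl_add[of q "- q'"] DX_add[of q "- q'"] by (simp_all add: neg)
  have sk: "B0 r p = - B0 p r" "B0 r q = - B0 q r" "B0 q p = - B0 p q"
    "B0 (Dl r) p = - B0 p (Dl r)" "B0 (Dl q) p = - B0 p (Dl q)" "B0 (Dl p) q = - B0 q (Dl p)"
    "B0 (Dl r) q = - B0 q (Dl r)" "B0 (Dl p) r = - B0 r (Dl p)" "B0 (Dl q) r = - B0 r (Dl q)"
    "B0 (DX r) p = - B0 p (DX r)" "B0 (DX q) p = - B0 p (DX q)" "B0 (DX p) q = - B0 q (DX p)"
    "B0 (DX r) q = - B0 q (DX r)" "B0 (DX p) r = - B0 r (DX p)" "B0 (DX q) r = - B0 r (DX q)"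
    by (rule B0_skew)+
  show ?thesis
    using B0_jacobi[of p q r]
    by (simp add: ore_br_eq B0_add_r Dl_add DX_add dif neg B0_mult_r Dl_mult DX_mult Dl_B0 DX_B0
        Dl_DX sk algebra_simps)
qed

lemma ore_br_self: "ore_br br \<delta> p p = 0"
  by (simp add: ore_br_eq B0_self)

lemma ore_br_scale_r:
  "ore_br br \<delta> p (poly_scale scale c q) = poly_scale scale c (ore_br br \<delta> p q)"
proof -
  have c: "\<delta> (scale c 1) = 0" "br a (scale c 1) = 0" for a
    using br_skew[of a 1] by (simp_all add: \<delta>_scale br_scale_r)
  have "ore_br br \<delta> p (monom (scale c 1) 0) = 0"
    by (induction p rule: poly_monom_induct) (simp_all add: ore_br_monom c ore_br_add_l)
  then show ?thesis
    using ore_br_mult_r[of p "monom (scale c 1) 0" q] by (simp add: poly_scale_smult monom_0)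
qed

lemma ore_br_poisson_algebra: "poisson_algebra (poly_scale scale) (ore_br br \<delta>)"
proof -
  interpret P: comm_algebra "poly_scale scale" by (rule poly_comm_algebra)
  have minus: "poly_scale scale c (- p) = - poly_scale scale c p" for c p
    by (simp add: poly_scale_smult)
  show ?thesis
  proof (intro poisson_algebra.intro P.comm_algebra_axioms poisson_algebra_axioms.intro)
    fix p q r :: "'a poly"
    show "ore_br br \<delta> p p = 0" by (rule ore_br_self)
    show "ore_br br \<delta> p (ore_br br \<delta> q r) + ore_br br \<delta> q (ore_br br \<delta> r p)
      + ore_br br \<delta> r (ore_br br \<delta> p q) = 0" by (rule ore_br_jacobi)
    show "ore_br br \<delta> p (q * r) = ore_br br \<delta> p q * r + q * ore_br br \<delta> p r"
      by (rule ore_br_mult_r)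
    show "ore_br br \<delta> (p * q) r = p * ore_br br \<delta> q r + ore_br br \<delta> p r * q"
      unfolding ore_br_skew[of "p * q" r] ore_br_skew[of q r] ore_br_skew[of p r]
      by (simp add: ore_br_mult_r algebra_simps)
    show "Vector_Spaces.linear (poly_scale scale) (poly_scale scale) (ore_br br \<delta> p)"
      by (simp add: P.linear_iff_scale ore_br_add_r ore_br_scale_r)
    have "ore_br br \<delta> (poly_scale scale c p) q = poly_scale scale c (ore_br br \<delta> p q)" for c p
      using ore_br_scale_r[of q c p] ore_br_skew[of "poly_scale scale c p" q] ore_br_skew[of p q]
      by (simp add: minus)
    then show "Vector_Spaces.linear (poly_scale scale) (poly_scale scale) (\<lambda>p. ore_br br \<delta> p q)"
      by (simp add: P.linear_iff_scale ore_br_add_l)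
  qed
qed

lemma ore_br_const: "ore_br br \<delta> [:a:] [:b:] = [:br a b:]"
  using ore_br_monom[of a 0 b 0] by (simp add: monom_0)

lemma ore_br_const_x: "ore_br br \<delta> [:a:] [:0, 1:] = [:\<delta> a:]"
proof -
  have "br a 1 = 0" using br_skew[of a 1] by simp
  then show ?thesis
    using ore_br_monom[of a 0 1 1] by (simp add: monom_0 monom_Suc)
qed

lemma ore_br_unique:
  assumes br': "poisson_algebra (poly_scale scale) br'"
    and const: "\<And>a b. br' [:a:] [:b:] = [:br a b:]"
    and const_x: "\<And>a. br' [:a:] [:0, 1:] = [:\<delta> a:]"
  shows "br' = ore_br br \<delta>"
proof -
  interpret P: poisson_algebra "poly_scale scale" br' by (rule br')
  interpret Q: poisson_algebra "poly_scale scale" "ore_br br \<delta>" by (rule ore_br_poisson_algebra)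
  have skewP: "br' p q = - br' q p" for p q
  proof -
    have "br' (p + q) (p + q) = 0" by (rule P.br_self)
    then have "br' p q + br' q p = 0"
      using P.br_linear_left P.br_linear_right
      by (simp add: P.linear_iff_scale P.br_self[of p] P.br_self[of q] add.commute)
    then show ?thesis by (simp add: eq_neg_iff_add_eq_0)
  qed
  define X where "X = [:0, 1 :: 'a:]"
  have monom: "monom a n = [:a:] * X ^ n" for a n
    by (simp add: monom_altdef X_def)
  have pow: "br' p (X ^ n) = ore_br br \<delta> p (X ^ n)" if "br' p X = ore_br br \<delta> p X" for p n
  proof (induction n)
    case 0
    show ?case using P.br_mult_right[of p 1 1] Q.br_mult_right[of p 1 1] by simp
  next
    case (Suc n)
    then show ?case by (simp add: P.br_mult_right Q.br_mult_right that)
  qed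
  have gen: "br' p q = ore_br br \<delta> p q"
    if "\<And>a. br' p [:a:] = ore_br br \<delta> p [:a:]" "br' p X = ore_br br \<delta> p X" for p q
  proof (induction q rule: poly_monom_induct)
    case (1 a n)
    show ?case by (simp only: monom P.br_mult_right Q.br_mult_right that(1) pow[OF that(2)])
  next
    case (2 q r)
    then show ?case using P.br_linear_right by (simp add: P.linear_iff_scale ore_br_add_r)
  qed
  have c: "br' [:a:] q = ore_br br \<delta> [:a:] q" for a q
    by (rule gen) (simp_all add: const ore_br_const X_def const_x ore_br_const_x)
  have x: "br' X q = ore_br br \<delta> X q" for q
  proof (rule gen)
    show "br' X [:a:] = ore_br br \<delta> X [:a:]" for a
      using c[of a X] skewP[of X "[:a:]"] ore_br_skew[of X "[:a:]"] by simp
  qed (simp add: P.br_self Q.br_self)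
  show ?thesis
  proof (rule ext, rule ext, rule gen)
    show "br' p [:a:] = ore_br br \<delta> p [:a:]" for p a
      using c[of a p] skewP[of p "[:a:]"] ore_br_skew[of p "[:a:]"] by simp
    show "br' p X = ore_br br \<delta> p X" for p
      using x[of p] skewP[of p X] ore_br_skew[of p X] by simp
  qed
qed

end

end

theory Submission
  imports Defs
begin

text \<open>
  Everything rests on one fact: if \<open>PML(A) = A\<close>, that is, if \<open>A\<close> has no nonzero locally nilpotent
  Poisson derivation, then each locally nilpotent Poisson derivation \<open>D\<close> of \<open>A[x;\<delta>]\<^sub>P\<close> kills \<open>A\<close>
  (\<open>locally_nilpotent_kills_constants\<close>). As \<open>A\<close> is affine, there is an \<open>n\<close> such that \<open>D\<close> raises
  degrees by at most \<open>n\<close>. The part of \<open>D\<close> that raises degrees by exactly \<open>n\<close>, its symbol, is again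
  a locally nilpotent derivation. For \<open>n \<ge> 0\<close> it sends \<open>x\<close> to a multiple of \<open>x\<close>, and in a domain of
  characteristic \<open>0\<close> a locally nilpotent derivation kills every element that divides its own
  image (\<open>locally_nilpotent_dvd_imp_zero\<close>). So the symbol kills \<open>x\<close> and is \<open>x\<^sup>n\<close> times a locally
  nilpotent derivation of \<open>A\<close>. The latter is Poisson, because \<open>\<delta>\<close> enters the bracket of
  \<open>A[x;\<delta>]\<^sub>P\<close> only in lower degree; hence it is zero by assumption. Thus \<open>D\<close> raises degrees by at most
  \<open>n - 1\<close>, and descent to \<open>n = -1\<close> shows that \<open>D\<close> lowers degrees, so that it kills \<open>A\<close>.

  The derivative in \<open>x\<close> is itself a locally nilpotent Poisson derivation, and its kernel is \<open>A\<close>. The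
  two facts together give the invariant of \<open>A[x;\<delta>]\<^sub>P\<close>.

  For cancellation, transport the derivative in \<open>y\<close> along an isomorphism of \<open>A[x;\<delta>]\<^sub>P\<close> with
  \<open>B[y;\<delta>']\<^sub>P\<close>. The resulting derivation of \<open>A[x;\<delta>]\<^sub>P\<close> kills \<open>A\<close>, hence is a nonzero multiple of the
  derivative in \<open>x\<close> and has kernel exactly \<open>A\<close>. The isomorphism therefore maps \<open>A\<close> onto the kernel of
  the derivative in \<open>y\<close>, which is \<open>B\<close>.
\<close>

section \<open>Locally nilpotent derivations\<close>

locale derivation =
  fixes D :: "'a::comm_ring_1 \<Rightarrow> 'a"
  assumes add: "D (a + b) = D a + D b"
    and mult: "D (a * b) = D a * b + a * D b"
begin

lemma additive: "additive D"
  by (rule additive.intro) (rule add)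

lemma zero [simp]: "D 0 = 0"
  using add[of 0 0] by simp

lemma one [simp]: "D 1 = 0"
  using mult[of 1 1] by simp

lemma sum: "D (\<Sum>i\<in>I. f i) = (\<Sum>i\<in>I. D (f i))"
  by (induction I rule: infinite_finite_induct) (simp_all add: add)

lemma funpow_zero [simp]: "(D ^^ k) 0 = 0"
  by (induction k) simp_all

lemma funpow_add: "(D ^^ k) (a + b) = (D ^^ k) a + (D ^^ k) b"
  by (induction k) (simp_all add: add)

lemma funpow_mult_kernel:
  assumes "D a = 0"
  shows "(D ^^ k) (a * b) = a * (D ^^ k) b"
  using assms by (induction k) (simp_all add: mult)

text \<open>
  In the general Leibniz formula for the \<open>k + m\<close>-th iterate, every term but one contains an iterate
  of \<open>a\<close> beyond the \<open>k\<close>-th or an iterate of \<open>b\<close> beyond the \<open>m\<close>-th.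
\<close>

lemma funpow_mult_top:
  assumes "(D ^^ Suc k) a = 0" "(D ^^ Suc m) b = 0"
  shows "(D ^^ (k + m)) (a * b) = of_nat ((k + m) choose k) * (D ^^ k) a * (D ^^ m) b"
  using assms
proof (induction "k + m" arbitrary: k m a b)
  case 0
  then show ?case by simp
next
  case (Suc N)
  consider "k = 0" | "m = 0" | k' m' where "k = Suc k'" "m = Suc m'"
    by (cases k; cases m) auto
  then show ?case
  proof cases
    case 1
    then show ?thesis using Suc.prems by (simp add: funpow_mult_kernel)
  next
    case 2
    then show ?thesis
      using Suc.prems funpow_mult_kernel[of b k a] by (simp add: mult.commute)
  next
    case (3 k' m')
    have N: "N = k' + m" "N = k + m'" using Suc.hyps(2) 3 by simp_all
    have "(D ^^ (k + m)) (a * b) = (D ^^ N) (D (a * b))"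
      by (simp only: Suc.hyps(2)[symmetric] funpow_Suc_right o_apply)
    also have "\<dots> = (D ^^ N) (D a * b) + (D ^^ N) (a * D b)"
      by (simp add: mult funpow_add)
    also have "(D ^^ N) (D a * b) = of_nat (N choose k') * (D ^^ k) a * (D ^^ m) b"
      using Suc.hyps(1)[OF N(1), of "D a" b] Suc.prems 3 N(1)
      by (simp add: funpow_swap1)
    also have "(D ^^ N) (a * D b) = of_nat (N choose k) * (D ^^ k) a * (D ^^ m) b"
      using Suc.hyps(1)[OF N(2), of a "D b"] Suc.prems 3 N(2)
      by (simp add: funpow_swap1)
    finally have "(D ^^ (k + m)) (a * b) =
        of_nat ((N choose k') + (N choose k)) * (D ^^ k) a * (D ^^ m) b"
      by (simp add: distrib_right)
    also have "(N choose k') + (N choose k) = (k + m) choose k"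
      using 3 N by simp
    finally show ?thesis .
  qed
qed

end

lemma locally_nilpotent_last_iterate:
  fixes D :: "'a::zero \<Rightarrow> 'a"
  assumes "locally_nilpotent D" "a \<noteq> 0"
  obtains k where "(D ^^ k) a \<noteq> 0" "(D ^^ Suc k) a = 0"
proof -
  obtain N where N: "(D ^^ N) a = 0"
    using assms(1) unfolding locally_nilpotent_def by blast
  then obtain k where "\<forall>i<Suc k. (D ^^ i) a \<noteq> 0" "(D ^^ Suc k) a = 0"
    using ex_least_nat_less[of "\<lambda>k. (D ^^ k) a = 0" N] assms(2)
    by (auto simp: less_Suc_eq_le)
  then show ?thesis using that[of k] by blast
qed

text \<open>
  The largest \<open>k\<close> whose \<open>k\<close>-th iterate does not kill a given nonzero element is additive on products:
  this is where a domain of characteristic \<open>0\<close> enters, through a binomial coefficient that must not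
  vanish. Applying \<open>D\<close> lowers \<open>k\<close> unless the result is zero, whereas passing to a nonzero multiple
  does not.
\<close>

lemma locally_nilpotent_dvd_imp_zero:
  fixes D :: "'a::idom \<Rightarrow> 'a"
  assumes "derivation D" "locally_nilpotent D"
    and char_0: "\<And>n. n \<noteq> 0 \<Longrightarrow> of_nat n \<noteq> (0::'a)"
    and dvd: "a dvd D a"
  shows "D a = 0"
proof (rule ccontr)
  assume Da: "D a \<noteq> 0"
  interpret derivation D by fact
  obtain b where b: "D a = a * b" using dvd by blast
  with Da have "a \<noteq> 0" "b \<noteq> 0" by auto
  obtain k where k: "(D ^^ k) a \<noteq> 0" "(D ^^ Suc k) a = 0"
    using locally_nilpotent_last_iterate[OF assms(2) \<open>a \<noteq> 0\<close>] .
  obtain m where m: "(D ^^ m) b \<noteq> 0" "(D ^^ Suc m) b = 0"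
    using locally_nilpotent_last_iterate[OF assms(2) \<open>b \<noteq> 0\<close>] .
  have "(D ^^ (k + m)) (a * b) = (D ^^ m) ((D ^^ Suc k) a)"
    by (simp add: b[symmetric] funpow_swap1 funpow_add[symmetric] add.commute[of k] Nat.funpow_add)
  then have "of_nat ((k + m) choose k) * (D ^^ k) a * (D ^^ m) b = 0"
    using funpow_mult_top[OF k(2) m(2)] k(2) by simp
  moreover have "of_nat ((k + m) choose k) \<noteq> (0::'a)"
    by (rule char_0) simp
  ultimately show False using k(1) m(1) by simp
qed

section \<open>The top symbol of a derivation of a polynomial ring\<close>

lemma derivation_monom:
  fixes D :: "'a::comm_ring_1 poly \<Rightarrow> 'a poly"
  assumes "derivation D"
  shows "D (monom a i) = monom 1 i * D [:a:] + monom (of_nat i * a) (i - 1) * D [:0, 1:]"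
proof -
  interpret derivation D by fact
  have X: "D (monom 1 i) = monom (of_nat i) (i - 1) * D [:0, 1:]"
  proof (induction i)
    case (Suc i)
    have "monom (1::'a) (Suc i) = [:0, 1:] * monom 1 i" by (simp add: monom_Suc)
    then have "D (monom 1 (Suc i)) = D [:0, 1:] * monom 1 i + [:0, 1:] * D (monom 1 i)"
      by (simp only: mult)
    also have "[:0, 1:] * D (monom 1 i) = monom (of_nat i) i * D [:0, 1:]"
      unfolding Suc.IH by (cases i) (simp_all add: monom_Suc)
    finally show ?case by (simp add: algebra_simps flip: add_monom)
  qed (simp add: monom_0 flip: one_pCons)
  have "monom a i = [:a:] * monom 1 i" by (simp add: smult_monom)
  then have "D (monom a i) = D [:a:] * monom 1 i + [:a:] * D (monom 1 i)"
    by (simp only: mult)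
  moreover have "monom (of_nat i * a) (i - 1) = [:a:] * monom (of_nat i) (i - 1)"
    by (simp add: smult_monom mult.commute)
  ultimately show ?thesis unfolding X by (simp only: ac_simps)
qed

lemma derivation_kills_constants:
  fixes D :: "'a::comm_ring_1 poly \<Rightarrow> 'a poly"
  assumes "derivation D" "\<And>a. D [:a:] = 0"
  shows "D p = (\<Sum>i\<le>degree p. monom (of_nat i * coeff p i) (i - 1)) * D [:0, 1:]"
proof -
  interpret derivation D by fact
  have "D p = D (\<Sum>i\<le>degree p. monom (coeff p i) i)"
    by (simp add: poly_as_sum_of_monoms)
  then show ?thesis
    by (simp add: sum derivation_monom[OF assms(1)] assms(2) sum_distrib_right)
qed

text \<open>
  A derivation that raises the degree by at most \<open>n\<close>. The bound need not be attained: the descent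
  below shows that it is not. The symbol is the part that raises the degree by exactly \<open>n\<close>; it maps
  \<open>a\<close> to \<open>base a * x\<^sup>n\<close> and \<open>x\<close> to \<open>slope * x\<^sup>n\<^sup>+\<^sup>1\<close>.
\<close>

locale degree_bounded_derivation = derivation D
  for D :: "'a::comm_ring_1 poly \<Rightarrow> 'a poly" +
  fixes n :: nat
  assumes degree_const: "degree (D [:a:]) \<le> n"
    and degree_X: "degree (D [:0, 1:]) \<le> Suc n"
begin

definition "base a = coeff (D [:a:]) n"
definition "slope = coeff (D [:0, 1:]) (Suc n)"
definition "symbol p = psum (\<lambda>i a. monom (base a + of_nat i * slope * a) (i + n)) p"

lemma base_add: "base (a + b) = base a + base b"
  using add[of "[:a:]" "[:b:]"] by (simp add: base_def)

lemma base_mult: "base (a * b) = base a * b + a * base b"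
  using mult[of "[:a:]" "[:b:]"] by (simp add: base_def mult.commute)

lemma coeff_D_monom: "j > i + n \<Longrightarrow> coeff (D (monom a i)) j = 0"
    "coeff (D (monom a i)) (i + n) = base a + of_nat i * slope * a"
proof -
  have c: "coeff (D [:a:]) j = 0" if "j > n" for j
    using degree_const[of a] that by (intro coeff_eq_0) simp
  have x: "coeff (D [:0, 1:]) j = 0" if "j > Suc n" for j
    using degree_X that by (intro coeff_eq_0) simp
  show "j > i + n \<Longrightarrow> coeff (D (monom a i)) j = 0"
    by (cases i) (simp_all add: derivation_monom[OF derivation_axioms] coeff_monom_mult c x)
  show "coeff (D (monom a i)) (i + n) = base a + of_nat i * slope * a"
  proof (cases i)
    case 0
    then show ?thesis
      by (simp add: derivation_monom[OF derivation_axioms] coeff_monom_mult base_def)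
  next
    case (Suc i')
    have "coeff (D (monom a i)) (i + n) =
        coeff (D [:a:]) n + of_nat i * a * coeff (D [:0, 1:]) (i + n - i')"
      using Suc by (simp add: derivation_monom[OF derivation_axioms] coeff_monom_mult del: of_nat_Suc)
    also have "i + n - i' = Suc n" using Suc by simp
    finally show ?thesis by (simp add: base_def slope_def ac_simps)
  qed
qed

lemma D_leading:
  assumes "degree p \<le> m"
  shows "degree (D p) \<le> m + n"
    "coeff (D p) (m + n) = base (coeff p m) + of_nat m * slope * coeff p m"
proof -
  have p: "p = (\<Sum>i\<le>m. monom (coeff p i) i)"
    using poly_as_sum_of_monoms'[OF assms] by simp
  have D: "coeff (D p) j = (\<Sum>i\<le>m. coeff (D (monom (coeff p i) i)) j)" for j
    by (subst p) (simp add: sum coeff_sum)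
  show "degree (D p) \<le> m + n"
    by (rule degree_le) (simp add: D coeff_D_monom)
  have "(\<Sum>i\<le>m. coeff (D (monom (coeff p i) i)) (m + n)) =
      (\<Sum>i\<le>m. if i = m then base (coeff p m) + of_nat m * slope * coeff p m else 0)"
    by (intro sum.cong) (auto simp: coeff_D_monom)
  then show "coeff (D p) (m + n) = base (coeff p m) + of_nat m * slope * coeff p m"
    by (simp add: D)
qed

lemma symbol_additive: "additive (\<lambda>a. monom (base a + of_nat i * slope * a) (i + n))"
  by (rule additive.intro) (simp add: base_add algebra_simps add_monom)

lemma symbol_monom: "symbol (monom a i) = monom (base a + of_nat i * slope * a) (i + n)"
  unfolding symbol_def by (rule psum_monom) (rule symbol_additive)

lemma derivation_symbol: "derivation symbol"
proof
  show add: "symbol (p + q) = symbol p + symbol q" for p q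
    unfolding symbol_def by (rule psum_add) (rule symbol_additive)
  show "symbol (p * q) = symbol p * q + p * symbol q" for p q
  proof (induction p rule: poly_monom_induct)
    case p: (1 a i)
    show ?case
    proof (induction q rule: poly_monom_induct)
      case (1 b j)
      show ?case
        by (simp add: symbol_monom mult_monom add_monom base_mult algebra_simps)
    qed (simp add: add algebra_simps)
  qed (simp add: add algebra_simps)
qed

lemma funpow_symbol_monom:
  "degree ((D ^^ k) (monom a m)) \<le> m + k * n \<and>
   (symbol ^^ k) (monom a m) = monom (coeff ((D ^^ k) (monom a m)) (m + k * n)) (m + k * n)"
proof (induction k)
  case 0
  show ?case by (simp add: degree_monom_le)
next
  case (Suc k)
  then show ?case
    using D_leading[of "(D ^^ k) (monom a m)" "m + k * n"]
    by (simp add: symbol_monom add_ac)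
qed

lemma locally_nilpotent_symbol:
  assumes "locally_nilpotent D"
  shows "locally_nilpotent symbol"
  unfolding locally_nilpotent_def
proof
  interpret S: derivation symbol by (rule derivation_symbol)
  show "\<exists>N. \<forall>k\<ge>N. (symbol ^^ k) p = 0" for p
  proof (induction p rule: poly_monom_induct)
    case (1 a m)
    obtain N where "\<forall>k\<ge>N. (D ^^ k) (monom a m) = 0"
      using assms unfolding locally_nilpotent_def by blast
    then show ?case by (intro exI[of _ N]) (simp add: funpow_symbol_monom)
  next
    case (2 p q)
    then obtain M N where "\<forall>k\<ge>M. (symbol ^^ k) p = 0" "\<forall>k\<ge>N. (symbol ^^ k) q = 0"
      by blast
    then show ?case by (intro exI[of _ "max M N"]) (simp add: S.funpow_add)
  qed
qed

end

locale degree_bounded_derivation_domain = degree_bounded_derivation D n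
  for D :: "'a::idom poly \<Rightarrow> 'a poly" and n +
  assumes char_0: "k \<noteq> 0 \<Longrightarrow> of_nat k \<noteq> (0::'a)"
    and nilpotent: "locally_nilpotent D"
begin

text \<open>The symbol maps \<open>x\<close> to \<open>slope * x\<^sup>n\<^sup>+\<^sup>1\<close>, a multiple of \<open>x\<close>, so it kills \<open>x\<close>.\<close>

lemma slope_eq_0: "slope = 0"
proof -
  have "[:0, 1:] = monom (1::'a) 1" by (simp add: monom_Suc monom_0)
  moreover have "base 1 = 0" by (simp add: base_def flip: one_pCons)
  ultimately have X: "symbol [:0, 1:] = monom slope (Suc n)" by (simp add: symbol_monom)
  have "symbol [:0, 1:] = 0"
  proof (rule locally_nilpotent_dvd_imp_zero[where D = symbol])
    show "[:0, 1:] dvd symbol [:0, 1:]"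
      unfolding X by (rule dvdI[of _ _ "monom slope n"]) (simp add: monom_Suc)
    show "of_nat k \<noteq> (0 :: 'a poly)" if "k \<noteq> 0" for k
      using char_0[OF that] by (simp add: of_nat_poly)
  qed (rule derivation_symbol locally_nilpotent_symbol nilpotent)+
  then show ?thesis using X by simp
qed

lemma locally_nilpotent_base: "locally_nilpotent base"
  unfolding locally_nilpotent_def
proof
  fix a
  have pow: "(symbol ^^ k) (monom a 0) = monom ((base ^^ k) a) (k * n)" for k
    by (induction k) (simp_all add: symbol_monom slope_eq_0 add.commute)
  obtain N where "\<forall>k\<ge>N. (symbol ^^ k) (monom a 0) = 0"
    using locally_nilpotent_symbol[OF nilpotent] unfolding locally_nilpotent_def by blast
  then show "\<exists>N. \<forall>k\<ge>N. (base ^^ k) a = 0"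
    unfolding pow by auto
qed

end

section \<open>The derivative in the Poisson-Ore variable\<close>

lemma poisson_derivation_iff:
  assumes "comm_algebra scale"
  shows "poisson_derivation scale br d \<longleftrightarrow>
    derivation d \<and> (\<forall>c a. d (scale c a) = scale c (d a)) \<and>
    (\<forall>a b. d (br a b) = br (d a) b + br a (d b))"
  by (auto simp: poisson_derivation_def derivation_def comm_algebra.linear_iff_scale[OF assms])

lemma poisson_derivation_imp_derivation:
  assumes "poisson_derivation scale br d"
  shows "derivation d"
  using assms module_hom.add[of scale scale d]
  by (auto simp: poisson_derivation_def derivation_def Vector_Spaces.linear_def)

lemma (in comm_algebra) of_nat_mult_eq_scale: "of_nat k * a = scale (of_nat k) a"
  by (induction k) (simp_all add: distrib_right scale_left_distrib)

context poisson_ore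
begin

lemma coeff_DX: "coeff (DX p) i = of_nat (Suc i) * (coeff p (Suc i) :: 'a)"
proof (induction p rule: poly_monom_induct)
  case (1 a n)
  show ?case by (cases n) (simp_all add: DX_monom)
qed (simp add: DX_add algebra_simps)

lemma derivation_DX: "derivation (DX :: 'a poly \<Rightarrow> _)"
  by (rule derivation.intro) (rule DX_add DX_mult)+

lemma DX_poisson_derivation: "poisson_derivation (poly_scale scale) (ore_br br \<delta>) DX"
proof -
  interpret P: derivation "DX :: 'a poly \<Rightarrow> 'a poly" by (rule derivation_DX)
  have "DX (poly_scale scale c p) = poly_scale scale c (DX p)" for c p
    by (rule poly_eqI) (simp add: coeff_poly_scale coeff_DX of_nat_mult_eq_scale mult.commute
        scale_mult_left[symmetric] scale_left_commute del: of_nat_Suc)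
  moreover have "DX (ore_br br \<delta> p q) = ore_br br \<delta> (DX p) q + ore_br br \<delta> p (DX q)" for p q
    by (simp add: ore_br_eq DX_add additive.diff[OF P.additive] DX_mult DX_B0 Dl_DX algebra_simps)
  ultimately show ?thesis
    by (simp add: poisson_derivation_iff[OF poly_comm_algebra] derivation_DX)
qed

lemma DX_locally_nilpotent: "locally_nilpotent (DX :: 'a poly \<Rightarrow> _)"
proof -
  have "(DX ^^ k) p = 0" if "\<forall>i\<ge>k. coeff p i = 0" for k and p :: "'a poly"
    using that
  proof (induction k arbitrary: p)
    case 0
    then show ?case by (simp add: poly_eq_iff)
  next
    case (Suc k)
    then have "(DX ^^ k) (DX p) = 0" by (simp add: coeff_DX)
    then show ?case by (simp add: funpow_swap1)
  qed
  moreover have "\<forall>i\<ge>k. coeff p i = 0" if "k \<ge> Suc (degree p)" for k and p :: "'a poly"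
    using that by (auto intro: coeff_eq_0)
  ultimately show ?thesis unfolding locally_nilpotent_def by blast
qed

end

locale poisson_ore_char_0 = poisson_ore scale br \<delta>
  for scale :: "'k::field_char_0 \<Rightarrow> 'a::comm_ring_1 \<Rightarrow> 'a" and br \<delta>
begin

lemma of_nat_mult_eq_0: "k \<noteq> 0 \<Longrightarrow> of_nat k * a = 0 \<longleftrightarrow> (a::'a) = 0"
  by (simp add: of_nat_mult_eq_scale)

lemma DX_eq_0_iff: "DX p = 0 \<longleftrightarrow> (\<exists>a :: 'a. p = [:a:])"
proof
  assume "DX p = 0"
  then have "coeff p (Suc i) = 0" for i
    using coeff_DX[of p i] of_nat_mult_eq_0[of "Suc i" "coeff p (Suc i)"] by (simp del: of_nat_Suc)
  then have "p = [:coeff p 0:]"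
    by (intro poly_eqI) (simp add: coeff_pCons split: nat.split)
  then show "\<exists>a. p = [:a:]" by blast
next
  assume "\<exists>a. p = [:a:]"
  then show "DX p = 0" by (auto simp: DX_monom simp flip: monom_0)
qed

end

section \<open>Locally nilpotent Poisson derivations of a Poisson-Ore extension\<close>

text \<open>
  A degree bound on the generators of \<open>A\<close> extends to \<open>A\<close>: by the Leibniz rule \<open>D(ab)\<close> is a
  combination of \<open>D(a)\<close> and \<open>D(b)\<close> with constant coefficients.
\<close>

lemma affine_degree_bound:
  assumes alg: "comm_algebra scale" and affine: "affine_algebra scale"
    and D: "derivation D" "\<And>c p. D (poly_scale scale c p) = poly_scale scale c (D p)"
  obtains N where "\<And>a. degree (D [:a:]) \<le> N"
proof -
  interpret comm_algebra scale by fact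
  interpret derivation D by fact
  obtain S where S: "finite S" "subalgebra scale hull S = UNIV"
    using affine unfolding affine_algebra_def by blast
  define N where "N = Max (insert 0 ((\<lambda>a. degree (D [:a:])) ` S))"
  define T where "T = {a. degree (D [:a:]) \<le> N}"
  have deg_scale: "degree (poly_scale scale c p) \<le> degree p" for c p
    by (rule degree_le) (simp add: coeff_poly_scale coeff_eq_0)
  have "S \<subseteq> T" using S(1) by (auto simp: T_def N_def)
  moreover have "subalgebra scale T"
    unfolding subalgebra_def subspace_def
  proof (intro conjI ballI allI)
    show "0 \<in> T" by (simp add: T_def)
    show "1 \<in> T" using one by (simp add: T_def one_pCons)
    show "a + b \<in> T" if "a \<in> T" "b \<in> T" for a b
      using that add[of "[:a:]" "[:b:]"] by (simp add: T_def degree_add_le)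
    show "scale c a \<in> T" if "a \<in> T" for a c
      using that D(2)[of c "[:a:]"] deg_scale[of c "D [:a:]"]
      by (simp add: T_def poly_scale_def map_poly_pCons)
    show "a * b \<in> T" if "a \<in> T" "b \<in> T" for a b
      using that mult[of "[:a:]" "[:b:]"] order_trans[OF degree_smult_le]
      by (auto simp: T_def mult.commute intro!: degree_add_le)
  qed
  ultimately have "T = UNIV" using S(2) hull_minimal[of S T "subalgebra scale"] by auto
  then show ?thesis using that[of N] unfolding T_def by blast
qed

locale poisson_ore_rigid = poisson_ore scale br \<delta>
  for scale :: "'k::field_char_0 \<Rightarrow> 'a::idom \<Rightarrow> 'a" and br \<delta> +
  assumes affine: "affine_algebra scale"
    and rigid: "PML scale br = UNIV"
begin

sublocale poisson_ore_char_0 ..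

lemma rigid_derivation:
  assumes "poisson_derivation scale br d" "locally_nilpotent d"
  shows "d a = 0"
proof -
  have "a \<in> PML scale br" by (simp add: rigid)
  then show ?thesis using assms by (simp add: PML_def)
qed

text \<open>
  The bracket of \<open>A[x;\<delta>]\<^sub>P\<close> with a constant is the coefficientwise bracket up to terms of lower
  degree, so the base of the symbol is a locally nilpotent Poisson derivation of \<open>A\<close>, hence zero.
\<close>

lemma symbol_vanishes:
  assumes D: "poisson_derivation (poly_scale scale) (ore_br br \<delta>) D" "locally_nilpotent D"
    and deg: "\<And>a. degree (D [:a:]) \<le> n" "degree (D [:0, 1:]) \<le> Suc n"
  shows "coeff (D [:a:]) n = 0" "coeff (D [:0, 1:]) (Suc n) = 0"
proof -
  have D': "derivation D" "\<And>c p. D (poly_scale scale c p) = poly_scale scale c (D p)"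
    "\<And>p q. D (ore_br br \<delta> p q) = ore_br br \<delta> (D p) q + ore_br br \<delta> p (D q)"
    using D(1) by (simp_all add: poisson_derivation_iff[OF poly_comm_algebra])
  interpret derivation D by (rule D')
  interpret degree_bounded_derivation_domain D n
  proof unfold_locales
    show "of_nat k \<noteq> (0::'a)" if "k \<noteq> 0" for k
      using of_nat_mult_eq_0[OF that, of 1] by simp
  qed (rule deg D)+
  have B0: "coeff (B0 p [:b:]) i = br (coeff p i) b" for p b i
    by (induction p rule: poly_monom_induct)
      (simp_all add: B0_monom B0_add_l br_add_l flip: monom_0)
  have br_const: "coeff (ore_br br \<delta> p [:b:]) n = br (coeff p n) b" if "degree p \<le> n" for p b
  proof -
    have "DX [:b:] = 0" by (auto simp: DX_eq_0_iff)
    moreover have "Dl [:b:] = [:\<delta> b:]" by (simp add: Dl_monom flip: monom_0)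
    moreover have "coeff p (Suc n) = 0" using that by (intro coeff_eq_0) simp
    ultimately show ?thesis by (simp add: ore_br_eq B0 coeff_DX)
  qed
  have "poisson_derivation scale br base"
    unfolding poisson_derivation_iff[OF comm_algebra_axioms]
  proof (intro conjI allI)
    show "derivation base" by unfold_locales (rule base_add base_mult)+
    show "base (scale c a) = scale c (base a)" for c a
      using D'(2)[of c "[:a:]"] coeff_poly_scale[of c "D [:a:]" n]
      by (simp add: base_def poly_scale_def map_poly_pCons)
    show "base (br a b) = br (base a) b + br a (base b)" for a b
    proof -
      have "base (br a b) = coeff (ore_br br \<delta> (D [:a:]) [:b:] + ore_br br \<delta> [:a:] (D [:b:])) n"
        using D'(3)[of "[:a:]" "[:b:]"] by (simp add: base_def ore_br_const)
      also have "\<dots> = br (base a) b - br (base b) a"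
        unfolding ore_br_skew[of "[:a:]" "D [:b:]"] by (simp add: br_const deg base_def)
      finally show ?thesis using br_skew[of "base b" a] by simp
    qed
  qed
  then have "base a = 0" by (rule rigid_derivation) (rule locally_nilpotent_base)
  then show "coeff (D [:a:]) n = 0" by (simp add: base_def)
  show "coeff (D [:0, 1:]) (Suc n) = 0" using slope_eq_0 by (simp add: slope_def)
qed

lemma locally_nilpotent_kills_constants:
  assumes D: "poisson_derivation (poly_scale scale) (ore_br br \<delta>) D" "locally_nilpotent D"
  shows "D [:a:] = 0"
proof -
  have D': "derivation D" "\<And>c p. D (poly_scale scale c p) = poly_scale scale c (D p)"
    using D(1) by (simp_all add: poisson_derivation_iff[OF poly_comm_algebra])
  obtain N where N: "\<And>a. degree (D [:a:]) \<le> N"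
    using affine_degree_bound[OF comm_algebra_axioms affine D'] by blast
  \<comment> \<open>The bounds are strict, so that the last step of the descent reaches the zero polynomial.\<close>
  define bounded where "bounded n \<longleftrightarrow>
    (\<forall>a i. i \<ge> n \<longrightarrow> coeff (D [:a:]) i = 0) \<and> (\<forall>i\<ge>Suc n. coeff (D [:0, 1:]) i = 0)" for n
  have "bounded (Suc (max N (degree (D [:0, 1:]))))"
    using N by (auto simp: bounded_def Suc_le_eq intro!: coeff_eq_0 le_less_trans[OF N])
  moreover have "bounded n" if "bounded (Suc n)" for n
  proof -
    have deg: "\<And>a. degree (D [:a:]) \<le> n" "degree (D [:0, 1:]) \<le> Suc n"
      using that by (auto simp: bounded_def intro!: degree_le)
    show ?thesis
      unfolding bounded_def
    proof (intro conjI allI impI)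
      show "coeff (D [:a:]) i = 0" if "i \<ge> n" for a i
        using that \<open>bounded (Suc n)\<close> symbol_vanishes(1)[OF D deg]
        by (cases "i = n") (auto simp: bounded_def)
      show "coeff (D [:0, 1:]) i = 0" if "i \<ge> Suc n" for i
        using that \<open>bounded (Suc n)\<close> symbol_vanishes(2)[OF D deg]
        by (cases "i = Suc n") (auto simp: bounded_def)
    qed
  qed
  ultimately have "bounded 0"
    by (rule inc_induct[OF le0])
  then show ?thesis by (intro poly_eqI) (simp add: bounded_def)
qed

lemma PML_ore: "PML (poly_scale scale) (ore_br br \<delta>) = range (\<lambda>a. [:a:])"
proof
  show "PML (poly_scale scale) (ore_br br \<delta>) \<subseteq> range (\<lambda>a. [:a:])"
  proof
    fix p
    assume "p \<in> PML (poly_scale scale) (ore_br br \<delta>)"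
    then have "DX p = 0"
      using DX_poisson_derivation DX_locally_nilpotent by (simp add: PML_def)
    then show "p \<in> range (\<lambda>a. [:a:])" by (auto simp: DX_eq_0_iff)
  qed
  show "range (\<lambda>a. [:a:]) \<subseteq> PML (poly_scale scale) (ore_br br \<delta>)"
  proof (rule image_subsetI)
    fix a
    have "D [:a:] = 0"
      if "poisson_derivation (poly_scale scale) (ore_br br \<delta>) D \<and> locally_nilpotent D" for D
      using that by (intro locally_nilpotent_kills_constants) simp_all
    then show "[:a:] \<in> PML (poly_scale scale) (ore_br br \<delta>)"
      unfolding PML_def by simp
  qed
qed

text \<open>
  A derivation that kills the constants is a multiple of the derivative in \<open>x\<close>, and in a domain a
  nonzero multiple has the same kernel.
\<close>

lemma locally_nilpotent_kernel:
  assumes D: "poisson_derivation (poly_scale scale) (ore_br br \<delta>) D" "locally_nilpotent D"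
    and nonzero: "D q \<noteq> 0"
  shows "D p = 0 \<longleftrightarrow> (\<exists>a. p = [:a:])"
proof -
  have D_eq: "D p = DX p * D [:0, 1:]" for p
    unfolding DX_def psum_def
    by (rule derivation_kills_constants[OF poisson_derivation_imp_derivation[OF D(1)]
        locally_nilpotent_kills_constants[OF D]])
  have "D [:0, 1:] \<noteq> 0" using nonzero unfolding D_eq[of q] by force
  then show ?thesis unfolding D_eq[of p] DX_eq_0_iff[symmetric] by simp
qed

end

section \<open>Poisson isomorphisms\<close>

lemma linear_iff_add_scale:
  assumes "vector_space s1" "vector_space s2"
  shows "Vector_Spaces.linear s1 s2 f \<longleftrightarrow>
    (\<forall>a b. f (a + b) = f a + f b) \<and> (\<forall>c a. f (s1 c a) = s2 c (f a))"
  using assms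
  by (auto simp: Vector_Spaces.linear_def module_hom_def module_hom_axioms_def module_iff_vector_space)

lemma poisson_iso_D:
  assumes "poisson_iso s1 br1 s2 br2 f"
  shows "bij f" "f (a + b) = f a + f b" "f (s1 c a) = s2 c (f a)" "f 1 = 1"
    "f (a * b) = f a * f b" "f (br1 a b) = br2 (f a) (f b)"
  using assms
  by (auto simp: poisson_iso_def Vector_Spaces.linear_def module_hom_def module_hom_axioms_def)

lemma poisson_derivation_conjugate:
  assumes alg: "comm_algebra s1" "comm_algebra s2"
    and iso: "poisson_iso s1 br1 s2 br2 f"
    and D: "poisson_derivation s2 br2 D" "locally_nilpotent D"
  defines "E \<equiv> \<lambda>a. inv f (D (f a))"
  shows "poisson_derivation s1 br1 E" "locally_nilpotent E"
proof -
  note f = poisson_iso_D[OF iso]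
  have fE: "f (E a) = D (f a)" for a
    unfolding E_def using f(1) by (simp add: bij_is_surj surj_f_inv_f)
  have inj: "f a = f b \<longleftrightarrow> a = b" for a b
    using f(1) by (simp add: bij_is_inj inj_eq)
  interpret D: derivation D using poisson_derivation_imp_derivation[OF D(1)] .
  have D': "\<And>c p. D (s2 c p) = s2 c (D p)"
    "\<And>p q. D (br2 p q) = br2 (D p) q + br2 p (D q)"
    using D(1) by (simp_all add: poisson_derivation_iff[OF alg(2)])
  show "poisson_derivation s1 br1 E"
    unfolding poisson_derivation_iff[OF alg(1)] derivation_def
    by (simp add: inj[symmetric] fE f D' D.add D.mult)
  have pow: "f ((E ^^ k) a) = (D ^^ k) (f a)" for k a
    by (induction k) (simp_all add: fE)
  have "f 0 = 0" using f(2)[of 0 0] by simp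
  then have zero: "(E ^^ k) a = 0 \<longleftrightarrow> (D ^^ k) (f a) = 0" for k a
    using inj[of "(E ^^ k) a" 0] by (simp add: pow)
  show "locally_nilpotent E"
    using D(2) unfolding locally_nilpotent_def zero by blast
qed

text \<open>
  The derivative in \<open>y\<close>, transported to \<open>A[x;\<delta>]\<^sub>P\<close>, has kernel \<open>A\<close>. Its kernel in \<open>B[y;\<delta>']\<^sub>P\<close> is \<open>B\<close>,
  so the isomorphism maps \<open>A\<close> onto \<open>B\<close>.
\<close>

lemma (in poisson_ore_rigid) ore_iso_imp_iso:
  fixes scaleB :: "'k \<Rightarrow> 'b::comm_ring_1 \<Rightarrow> 'b"
  assumes B: "poisson_algebra scaleB brB" "poisson_derivation scaleB brB \<delta>'"
    and iso: "poisson_iso (poly_scale scale) (ore_br br \<delta>) (poly_scale scaleB) (ore_br brB \<delta>') \<phi>"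
  shows "poisson_isomorphic scale br scaleB brB"
proof -
  interpret B: poisson_ore_char_0 scaleB brB \<delta>'
    using B by (intro poisson_ore_char_0.intro poisson_ore.intro poisson_ore_axioms.intro)
  note \<phi> = poisson_iso_D[OF iso]
  have inj: "\<phi> p = \<phi> q \<longleftrightarrow> p = q" for p q
    using \<phi>(1) by (simp add: bij_is_inj inj_eq)
  define E where "E = (\<lambda>p. inv \<phi> (B.DX (\<phi> p)))"
  have E: "poisson_derivation (poly_scale scale) (ore_br br \<delta>) E" "locally_nilpotent E"
    unfolding E_def
    using poisson_derivation_conjugate[OF poly_comm_algebra B.poly_comm_algebra iso
      B.DX_poisson_derivation B.DX_locally_nilpotent] by blast+
  have \<phi>E: "\<phi> (E p) = B.DX (\<phi> p)" for p
    unfolding E_def using \<phi>(1) by (simp add: bij_is_surj surj_f_inv_f)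
  have \<phi>0: "\<phi> 0 = 0" using \<phi>(2)[of 0 0] by simp
  have E_zero: "E p = 0 \<longleftrightarrow> (\<exists>b. \<phi> p = [:b:])" for p
    using inj[of "E p" 0] by (simp add: \<phi>E \<phi>0 B.DX_eq_0_iff)
  obtain y where "\<phi> y = [:0, 1:]" using \<phi>(1) by (metis bij_pointE)
  then have "E y \<noteq> 0" by (simp add: E_zero)
  then have const_iff: "(\<exists>b. \<phi> p = [:b:]) \<longleftrightarrow> (\<exists>a. p = [:a:])" for p
    using locally_nilpotent_kernel[OF E] E_zero by blast
  define f where "f a = coeff (\<phi> [:a:]) 0" for a
  have \<phi>_const: "\<phi> [:a:] = [:f a:]" for a
    using const_iff[of "[:a:]"] unfolding f_def by force
  have "bij f"
  proof (rule bijI)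
    show "inj f"
    proof (rule injI)
      fix a b
      assume "f a = f b"
      then have "\<phi> [:a:] = \<phi> [:b:]" by (simp add: \<phi>_const)
      then show "a = b" by (simp add: inj)
    qed
    show "surj f"
    proof (rule surjI)
      fix b
      obtain p where p: "\<phi> p = [:b:]" using \<phi>(1) by (metis bij_pointE)
      then have "p = [:coeff p 0:]" using const_iff[of p] by force
      then have "\<phi> [:coeff p 0:] = [:b:]" using p by simp
      then show "f (coeff (inv \<phi> [:b:]) 0) = b"
        using p inv_f_f[OF bij_is_inj[OF \<phi>(1)], of p] by (simp add: \<phi>_const)
    qed
  qed
  moreover have "f (a + b) = f a + f b" for a b
    using \<phi>(2)[of "[:a:]" "[:b:]"] by (simp add: \<phi>_const)
  moreover have "f (scale c a) = scaleB c (f a)" for c a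
    using \<phi>(3)[of c "[:a:]"] by (simp add: poly_scale_def map_poly_pCons \<phi>_const)
  moreover have "f 1 = 1"
    using \<phi>(4) by (simp add: one_pCons \<phi>_const)
  moreover have "f (a * b) = f a * f b" for a b
    using \<phi>(5)[of "[:a:]" "[:b:]"] by (simp add: \<phi>_const mult.commute)
  moreover have "f (br a b) = brB (f a) (f b)" for a b
    using \<phi>(6)[of "[:a:]" "[:b:]"] by (simp add: \<phi>_const ore_br_const B.ore_br_const)
  ultimately show ?thesis
    unfolding poisson_isomorphic_def poisson_iso_def
    by (auto simp: linear_iff_add_scale[OF vector_space_axioms B.vector_space_axioms])
qed

theorem theorem4p5:
  fixes scale :: "'k::field_char_0 \<Rightarrow> 'a::idom \<Rightarrow> 'a"
    and br :: "'a \<Rightarrow> 'a \<Rightarrow> 'a"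
  assumes "poisson_algebra scale br"
    and "affine_algebra scale"
    and "PML scale br = UNIV"
  shows "(\<forall>\<delta>. poisson_derivation scale br \<delta> \<longrightarrow>
             PML (poly_scale scale) (ore_br br \<delta>) = (\<lambda>a. [:a:]) ` PML scale br)
       \<and> poisson_delta_cancellative TYPE('b::comm_ring_1) scale br"
proof -
  have ore: "poisson_ore_rigid scale br \<delta>" if "poisson_derivation scale br \<delta>" for \<delta>
    using that assms
    by (intro poisson_ore_rigid.intro poisson_ore.intro poisson_ore_axioms.intro
        poisson_ore_rigid_axioms.intro)
  show ?thesis
  proof (intro conjI allI impI)
    show "PML (poly_scale scale) (ore_br br \<delta>) = (\<lambda>a. [:a:]) ` PML scale br"
      if "poisson_derivation scale br \<delta>" for \<delta>
      unfolding assms(3) by (rule poisson_ore_rigid.PML_ore[OF ore[OF that]])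
    show "poisson_delta_cancellative TYPE('b) scale br"
      unfolding poisson_delta_cancellative_def
      by (metis ore poisson_ore_rigid.ore_iso_imp_iso poisson_isomorphic_def)
  qed
qed

end
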